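(* Let $q\ge 2$, let $M$ be a $q\times q$ stochastic matrix with all entries strictly positive and invariant probability vector $\alpha$, let $T$ be an infinite rooted tree without leaves in which every vertex has finitely many children, and let $\mathbb{P}$ be the tree-indexed Markov chain on $\{1,\dots,q\}^T$ with transition matrix $M$ in equilibrium. Then for every $N\ge 1$ and every vertex $v\in T$ with $|v|<N$, $$\int \mathbb{P}(d\xi)\,L(\pi^{N,\xi}_v)=\sum_{w:\,v\to w}\int\mathbb{P}(d\xi)\,L(\pi^{N,\xi}_w M^{\mathrm{rev}}).$$
   Context: Trees: $0$ is the root of $T$, $v\to w$ means $w$ is a child of $v$, $|v|$ is the distance of $v$ to the root, $T^N$ is the subtree of vertices with $|v|\le N$. For $|v|\le N$, $T^N_v$ is the subtree of $T^N$ consisting of $v$ and its descendants in $T^N$, and $\partial T^N_v$ is the set of vertices of $T^N_v$ at distance $N$ from the root $0$. Measures: $\mathbb{P}$ is the probability measure on $\{1,\dots,q\}^T$ with marginals $\mathbb{P}_{T^N}(\sigma_{T^N})=\alpha(\sigma(0))\prod_{v\to w}M(\sigma(v),\sigma(w))$ on $\{1,\dots,q\}^{T^N}$ (product over pairs $v\to w$ in $T^N$), where $\sum_i\alpha(i)M(i,j)=\alpha(j)$; all $\alpha(i)>0$. $\mathbb{P}^N_v$ is the analogous measure on $\{1,\dots,q\}^{T^N_v}$, i.e. the Markov chain on $T^N_v$ with root $v$, transition matrix $M$, and $\sigma(v)$ distributed as $\alpha$. For a boundary configuration $\xi$, $\mathbb{P}^{N,\xi}_v$ is $\mathbb{P}^N_v$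 conditioned on $\sigma=\xi$ on $\partial T^N_v$, and $\pi^{N,\xi}_v=\big(\mathbb{P}^{N,\xi}_v(\sigma(v)=s)\big)_{s=1,\dots,q}$, a probability vector depending only on $\xi|_{\partial T^N_v}$. In $\int\mathbb{P}(d\xi)$, $\xi$ is the restriction to $\{w:|w|=N\}$ of a configuration with law $\mathbb{P}$. Entropy: for a probability vector $p$ of length $q$, $L(p)=S(p|\alpha)+S(\alpha|p)=\sum_{i=1}^q(p(i)-\alpha(i))\log\frac{p(i)}{\alpha(i)}\in[0,\infty]$ ($+\infty$ if some $p(i)=0$), where $S(p|\alpha)=\sum_i p(i)\log\frac{p(i)}{\alpha(i)}$. Reversed chain: $M^{\mathrm{rev}}(i,j)=\frac{\alpha(j)M(j,i)}{\alpha(i)}$ and $(pM^{\mathrm{rev}})(j)=\sum_i p(i)M^{\mathrm{rev}}(i,j)$. *)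

theory Defs
  imports "HOL-Probability.Probability"
begin

text \<open>A rooted tree is given by its vertex set \<open>V\<close>, its root \<open>r\<close> and the relation \<open>E\<close> consisting of
  the pairs \<open>(v, w)\<close> such that \<open>w\<close> is a child of \<open>v\<close>.\<close>

locale rooted_tree =
  fixes V :: "'v set" and r :: 'v and E :: "('v \<times> 'v) set"
  assumes root_in: "r \<in> V"
    and edges_in: "E \<subseteq> V \<times> V"
    and root_no_parent: "(v, r) \<notin> E"
    and unique_parent: "w \<in> V \<Longrightarrow> w \<noteq> r \<Longrightarrow> \<exists>!v. (v, w) \<in> E"
    and reachable: "w \<in> V \<Longrightarrow> (r, w) \<in> E\<^sup>*"

definition depth :: "'v \<Rightarrow> ('v \<times> 'v) set \<Rightarrow> 'v \<Rightarrow> nat" where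
  "depth r E v = (LEAST n. (r, v) \<in> E ^^ n)"

text \<open>\<open>subtree V r E N v\<close> is $T^N_v$ and \<open>subtree_boundary V r E N v\<close> is $\partial T^N_v$. Note that the
  height is measured from the root \<open>r\<close> of the whole tree, and that $T^N$ is $T^N_r$.\<close>

definition subtree :: "'v set \<Rightarrow> 'v \<Rightarrow> ('v \<times> 'v) set \<Rightarrow> nat \<Rightarrow> 'v \<Rightarrow> 'v set" where
  "subtree V r E N v = {u \<in> V. (v, u) \<in> E\<^sup>* \<and> depth r E u \<le> N}"

definition subtree_boundary :: "'v set \<Rightarrow> 'v \<Rightarrow> ('v \<times> 'v) set \<Rightarrow> nat \<Rightarrow> 'v \<Rightarrow> 'v set" where
  "subtree_boundary V r E N v = {u \<in> subtree V r E N v. depth r E u = N}"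

definition prob_vector :: "real ^ 's \<Rightarrow> bool" where
  "prob_vector p \<longleftrightarrow> (\<forall>i. 0 \<le> p $ i) \<and> (\<Sum>i\<in>UNIV. p $ i) = 1"

definition stochastic_matrix :: "real ^ 's ^ 's \<Rightarrow> bool" where
  "stochastic_matrix M \<longleftrightarrow> (\<forall>i. prob_vector (M $ i))"

definition chain_weight ::
  "('v \<times> 'v) set \<Rightarrow> real ^ 's \<Rightarrow> real ^ 's ^ 's \<Rightarrow> 'v set \<Rightarrow> 'v \<Rightarrow> ('v \<Rightarrow> 's) \<Rightarrow> real" where
  "chain_weight E \<alpha> M D v \<sigma> =
     \<alpha> $ (\<sigma> v) * (\<Prod>(u, w)\<in>E \<inter> D \<times> D. M $ (\<sigma> u) $ (\<sigma> w))"

text \<open>\<open>P\<close> is the law on the configurations \<open>V \<rightarrow> 's\<close> (with the product sigma-algebra) of the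
  tree-indexed Markov chain started from \<open>\<alpha>\<close>; it is determined by its marginals on the finite sets
  $T^N$.\<close>

definition tree_markov_chain ::
  "'v set \<Rightarrow> 'v \<Rightarrow> ('v \<times> 'v) set \<Rightarrow> real ^ 's \<Rightarrow> real ^ 's ^ 's \<Rightarrow> ('v \<Rightarrow> 's) measure \<Rightarrow> bool" where
  "tree_markov_chain V r E \<alpha> M P \<longleftrightarrow>
     prob_space P \<and>
     sets P = sets (\<Pi>\<^sub>M v\<in>V. count_space UNIV) \<and>
     (\<forall>N. \<forall>\<sigma> \<in> subtree V r E N r \<rightarrow>\<^sub>E UNIV.
        measure P {\<tau> \<in> space P. restrict \<tau> (subtree V r E N r) = \<sigma>} =
        chain_weight E \<alpha> M (subtree V r E N r) r \<sigma>)"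

text \<open>The measures $\mathbb{P}^N_v$ and $\mathbb{P}^{N,\xi}_v$ on the finite set of configurations on
  $T^N_v$, and the vector $\pi^{N,\xi}_v$. Of \<open>\<xi>\<close> only its values on $\partial T^N_v$ are used, so \<open>\<xi>\<close> may
  be a configuration on the whole tree.\<close>

definition subtree_chain ::
  "'v set \<Rightarrow> 'v \<Rightarrow> ('v \<times> 'v) set \<Rightarrow> real ^ 's \<Rightarrow> real ^ 's ^ 's \<Rightarrow> nat \<Rightarrow> 'v \<Rightarrow> ('v \<Rightarrow> 's) measure" where
  "subtree_chain V r E \<alpha> M N v =
     point_measure (subtree V r E N v \<rightarrow>\<^sub>E UNIV)
       (\<lambda>\<sigma>. ennreal (chain_weight E \<alpha> M (subtree V r E N v) v \<sigma>))"

definition conditioned_chain ::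
  "'v set \<Rightarrow> 'v \<Rightarrow> ('v \<times> 'v) set \<Rightarrow> real ^ 's \<Rightarrow> real ^ 's ^ 's \<Rightarrow> nat \<Rightarrow> ('v \<Rightarrow> 's) \<Rightarrow> 'v
     \<Rightarrow> ('v \<Rightarrow> 's) measure" where
  "conditioned_chain V r E \<alpha> M N \<xi> v =
     uniform_measure (subtree_chain V r E \<alpha> M N v)
       {\<sigma> \<in> space (subtree_chain V r E \<alpha> M N v). \<forall>w \<in> subtree_boundary V r E N v. \<sigma> w = \<xi> w}"

definition root_law ::
  "'v set \<Rightarrow> 'v \<Rightarrow> ('v \<times> 'v) set \<Rightarrow> real ^ 's \<Rightarrow> real ^ 's ^ 's \<Rightarrow> nat \<Rightarrow> ('v \<Rightarrow> 's) \<Rightarrow> 'v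
     \<Rightarrow> real ^ 's" where
  "root_law V r E \<alpha> M N \<xi> v =
     (\<chi> s. measure (conditioned_chain V r E \<alpha> M N \<xi> v)
            {\<sigma> \<in> space (conditioned_chain V r E \<alpha> M N \<xi> v). \<sigma> v = s})"

text \<open>With the usual conventions $0 \log (0/x) = 0$ and $x \log (x/0) = \infty$ for $x > 0$.\<close>

definition rel_entropy :: "real ^ 's \<Rightarrow> real ^ 's \<Rightarrow> ereal" where
  "rel_entropy p p' =
     (if \<exists>i. p $ i \<noteq> 0 \<and> p' $ i = 0 then \<infinity>
      else ereal (\<Sum>i\<in>UNIV. p $ i * ln (p $ i / p' $ i)))"

definition sym_entropy :: "real ^ 's \<Rightarrow> real ^ 's \<Rightarrow> ereal" where
  "sym_entropy \<alpha> p = rel_entropy p \<alpha> + rel_entropy \<alpha> p"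

definition rev_matrix :: "real ^ 's \<Rightarrow> real ^ 's ^ 's \<Rightarrow> real ^ 's ^ 's" where
  "rev_matrix \<alpha> M = (\<chi> i j. \<alpha> $ j * M $ j $ i / \<alpha> $ i)"

lemma sym_entropy_altdef:
  fixes \<alpha> p :: "real ^ 's"
  assumes p: "prob_vector p" and \<alpha>: "\<And>i. \<alpha> $ i > 0"
  shows "sym_entropy \<alpha> p =
    (if \<exists>i. p $ i = 0 then \<infinity>
     else ereal (\<Sum>i\<in>UNIV. (p $ i - \<alpha> $ i) * ln (p $ i / \<alpha> $ i)))"
proof -
  have na: "\<alpha> $ i \<noteq> 0" for i using \<alpha>[of i] by simp
  show ?thesis
  proof (cases "\<exists>i. p $ i = 0")
    case True
    then show ?thesis by (auto simp: sym_entropy_def rel_entropy_def na)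
  next
    case False
    then have pos: "p $ i > 0" for i
      using p by (metis less_eq_real_def prob_vector_def)
    have "p $ i * ln (p $ i / \<alpha> $ i) + \<alpha> $ i * ln (\<alpha> $ i / p $ i)
        = (p $ i - \<alpha> $ i) * ln (p $ i / \<alpha> $ i)" for i
      using pos[of i] \<alpha>[of i] by (simp add: ln_div algebra_simps)
    then show ?thesis using False
      by (simp add: sym_entropy_def rel_entropy_def na flip: sum.distrib)
  qed
qed

lemma sym_entropy_nonneg:
  fixes \<alpha> p :: "real ^ 's"
  assumes p: "prob_vector p" and \<alpha>: "\<And>i. \<alpha> $ i > 0"
  shows "0 \<le> sym_entropy \<alpha> p"
proof (cases "\<exists>i. p $ i = 0")
  case False
  then have pos: "p $ i > 0" for i
    using p by (metis less_eq_real_def prob_vector_def)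
  have "0 \<le> (p $ i - \<alpha> $ i) * ln (p $ i / \<alpha> $ i)" for i
    using pos[of i] \<alpha>[of i] by (cases "p $ i \<ge> \<alpha> $ i") (auto simp: mult_nonpos_nonpos)
  then show ?thesis using False
    by (simp add: sym_entropy_altdef[OF assms] sum_nonneg)
qed (simp add: sym_entropy_altdef[OF assms])

lemma invariant_vector_pos:
  fixes \<alpha> :: "real ^ 's"
  assumes "prob_vector \<alpha>" and "\<alpha> v* M = \<alpha>" and pos: "\<And>i j. M $ i $ j > 0"
  shows "\<alpha> $ j > 0"
proof -
  have nn: "\<And>i. 0 \<le> \<alpha> $ i" and one: "(\<Sum>i\<in>UNIV. \<alpha> $ i) = 1"
    using assms(1) by (auto simp: prob_vector_def)
  have "\<exists>i. \<alpha> $ i \<noteq> 0"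
    using one by (metis sum.neutral zero_neq_one)
  then obtain i where i: "\<alpha> $ i > 0"
    using nn by (metis less_eq_real_def)
  have "0 < (\<Sum>i\<in>UNIV. M $ i $ j * \<alpha> $ i)"
    by (rule sum_pos2[of _ i]) (use i pos nn in \<open>auto simp: less_imp_le\<close>)
  also have "\<dots> = (\<alpha> v* M) $ j"
    by (simp add: vector_matrix_mult_def mult.commute)
  finally show ?thesis using assms(2) by simp
qed

end

theory Submission
  imports Defs
begin

text \<open>Let \<open>Z v i \<xi>\<close> be the likelihood of the boundary condition \<open>\<xi>\<close> on $\partial T^N_v$ given that
  the spin at \<open>v\<close> is \<open>i\<close>, and let \<open>Y w i \<xi>\<close> be the likelihood of \<open>\<xi>\<close> on $\partial T^N_w$ given that the
  spin at the parent of \<open>w\<close> is \<open>i\<close>. By Bayes, $\pi_v$ and $\pi_w M^{\mathrm{rev}}$ have densities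
  proportional to \<open>Z v\<close> and \<open>Y w\<close> with respect to \<open>\<alpha>\<close>, and \<open>Z v\<close> is the product of the \<open>Y w\<close> over
  the children \<open>w\<close> of \<open>v\<close>. As $\pi_v - \alpha$ has total mass 0, the normalisation drops out of the
  logarithm in $L(\pi_v)$, which therefore splits into a sum of terms
  $\sum_i (\pi_v(i) - \alpha(i)) \log Y_w(i)$. Averaging over the boundary spins outside
  $\partial T^N_w$ replaces $\pi_v$ by $\pi_w M^{\mathrm{rev}}$.\<close>

section \<open>Sums over functions on a disjoint union\<close>

text \<open>Restriction to the pieces is inverted by gluing: by disjointness each point of the union
  has exactly one index, which \<open>THE\<close> recovers.\<close>

lemma bij_betw_PiE_UN:
  assumes "disjoint_family_on A W"
  shows "bij_betw (\<lambda>\<sigma>. \<lambda>w\<in>W. restrict \<sigma> (A w)) (PiE (\<Union>w\<in>W. A w) S) (\<Pi>\<^sub>E w\<in>W. PiE (A w) S)"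
proof -
  have ix: "(THE w. w \<in> W \<and> x \<in> A w) = w" if "w \<in> W" "x \<in> A w" for w x
    using that assms by (auto simp: disjoint_family_on_def intro!: the_equality)
  show ?thesis
  proof (rule bij_betw_byWitness[where f' = "\<lambda>g. \<lambda>x\<in>(\<Union>w\<in>W. A w). g (THE w. w \<in> W \<and> x \<in> A w) x"])
    show "\<forall>\<sigma>\<in>PiE (\<Union>w\<in>W. A w) S.
       (\<lambda>x\<in>(\<Union>w\<in>W. A w). (\<lambda>w\<in>W. restrict \<sigma> (A w)) (THE w. w \<in> W \<and> x \<in> A w) x) = \<sigma>"
    proof (intro ballI ext)
      fix \<sigma> x assume s: "\<sigma> \<in> PiE (\<Union>w\<in>W. A w) S"
      show "(\<lambda>x\<in>(\<Union>w\<in>W. A w). (\<lambda>w\<in>W. restrict \<sigma> (A w)) (THE w. w \<in> W \<and> x \<in> A w) x) x = \<sigma> x"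
      proof (cases "x \<in> (\<Union>w\<in>W. A w)")
        case True
        then obtain w where "w \<in> W" "x \<in> A w" by auto
        then show ?thesis using ix[of w x] by auto
      next
        case False
        then show ?thesis using PiE_arb[OF s False] by simp
      qed
    qed
    show "\<forall>g\<in>\<Pi>\<^sub>E w\<in>W. PiE (A w) S.
       (\<lambda>w\<in>W. restrict (\<lambda>x\<in>(\<Union>w\<in>W. A w). g (THE w. w \<in> W \<and> x \<in> A w) x) (A w)) = g"
    proof (intro ballI ext)
      fix g w x assume g: "g \<in> (\<Pi>\<^sub>E w\<in>W. PiE (A w) S)"
      show "(\<lambda>w\<in>W. restrict (\<lambda>x\<in>(\<Union>w\<in>W. A w). g (THE w. w \<in> W \<and> x \<in> A w) x) (A w)) w x = g w x"
      proof (cases "w \<in> W")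
        case w: True
        then have gw: "g w \<in> PiE (A w) S" using g by auto
        show ?thesis
        proof (cases "x \<in> A w")
          case True
          then show ?thesis using w ix[of w x] by auto
        next
          case False
          then show ?thesis using w PiE_arb[OF gw False] by simp
        qed
      next
        case False
        then show ?thesis using PiE_arb[OF g False] by simp
      qed
    qed
    show "(\<lambda>\<sigma>. \<lambda>w\<in>W. restrict \<sigma> (A w)) ` PiE (\<Union>w\<in>W. A w) S \<subseteq> (\<Pi>\<^sub>E w\<in>W. PiE (A w) S)"
      by fastforce
    show "(\<lambda>g. \<lambda>x\<in>(\<Union>w\<in>W. A w). g (THE w. w \<in> W \<and> x \<in> A w) x) ` (\<Pi>\<^sub>E w\<in>W. PiE (A w) S)
       \<subseteq> PiE (\<Union>w\<in>W. A w) S"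
    proof (intro image_subsetI PiE_I)
      fix g x assume g: "g \<in> (\<Pi>\<^sub>E w\<in>W. PiE (A w) S)" and x: "x \<in> (\<Union>w\<in>W. A w)"
      from x obtain w where w: "w \<in> W" "x \<in> A w" by auto
      then have "g w x \<in> S x" using g by (meson PiE_mem)
      then show "(\<lambda>x\<in>(\<Union>w\<in>W. A w). g (THE w. w \<in> W \<and> x \<in> A w) x) x \<in> S x"
        using w ix[OF w] by auto
    qed auto
  qed
qed

text \<open>Distributivity turns the product of sums into a sum over families of functions, and by
  disjointness such a family is a single function on the union. This later expresses the
  independence of the branches below a vertex given its spin.\<close>

lemma sum_PiE_UN:
  fixes f :: "'w \<Rightarrow> ('a \<Rightarrow> 'b) \<Rightarrow> 'c::comm_semiring_1"
  assumes "finite W" "\<And>w. w \<in> W \<Longrightarrow> finite (A w)" "disjoint_family_on A W"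
    and "\<And>x. finite (S x)"
  shows "(\<Sum>\<sigma>\<in>PiE (\<Union>w\<in>W. A w) S. \<Prod>w\<in>W. f w (restrict \<sigma> (A w)))
    = (\<Prod>w\<in>W. \<Sum>\<sigma>\<in>PiE (A w) S. f w \<sigma>)"
proof -
  have "(\<Prod>w\<in>W. \<Sum>\<sigma>\<in>PiE (A w) S. f w \<sigma>) = (\<Sum>g\<in>(\<Pi>\<^sub>E w\<in>W. PiE (A w) S). \<Prod>w\<in>W. f w (g w))"
    using assms by (intro prod_sum_PiE ballI finite_PiE) auto
  also have "\<dots> = (\<Sum>\<sigma>\<in>PiE (\<Union>w\<in>W. A w) S. \<Prod>w\<in>W. f w ((\<lambda>w\<in>W. restrict \<sigma> (A w)) w))"
    by (rule sum.reindex_bij_betw[OF bij_betw_PiE_UN, symmetric]) fact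
  finally show ?thesis by simp
qed

text \<open>Serves to split off the spin at the top of a subtree from the spins below it.\<close>

lemma sum_PiE_insert:
  assumes "finite A" "x \<notin> A" "\<And>y. finite (S y)"
  shows "(\<Sum>\<sigma>\<in>PiE (insert x A) S. f \<sigma>) = (\<Sum>s\<in>S x. \<Sum>\<tau>\<in>PiE A S. f (\<tau>(x := s)))"
  unfolding PiE_insert_eq
  by (subst sum.reindex[OF inj_combinator[OF assms(2)]]) (simp add: sum.cartesian_product split_def)

lemma sum_of_bool_eq_mult:
  fixes g :: "'a \<Rightarrow> 'b::semiring_1"
  assumes "finite A" "a \<in> A"
  shows "(\<Sum>x\<in>A. of_bool (x = a) * g x) = g a"
proof -
  have "(\<Sum>x\<in>A. of_bool (x = a) * g x) = (\<Sum>x\<in>A. if x = a then g x else 0)"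
    by (intro sum.cong) auto
  then show ?thesis using assms by simp
qed

lemma prod_of_bool:
  "finite A \<Longrightarrow> (\<Prod>x\<in>A. of_bool (P x)) = (of_bool (\<forall>x\<in>A. P x) :: 'b::comm_semiring_1)"
  by (induction A rule: finite_induct) auto

section \<open>Cylinder events\<close>

text \<open>Restriction to \<open>A\<close> is measurable into the product over \<open>A\<close>,
  and there a singleton is a box with finitely many sides.\<close>

lemma cylinder_in_sets:
  assumes "sets P = sets (\<Pi>\<^sub>M v\<in>V. count_space UNIV)" and "A \<subseteq> V" "finite A"
    and "\<eta> \<in> A \<rightarrow>\<^sub>E UNIV"
  shows "{\<xi> \<in> space P. restrict \<xi> A = \<eta>} \<in> sets P"
proof -
  have "(\<lambda>\<xi>. restrict \<xi> A) \<in> measurable P (\<Pi>\<^sub>M v\<in>A. count_space UNIV)"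
    by (simp add: measurable_cong_sets[OF assms(1) refl] measurable_restrict_subset assms)
  moreover have "{\<eta>} \<in> sets (\<Pi>\<^sub>M v\<in>A. count_space UNIV)"
  proof -
    have "{\<eta>} = PiE A (\<lambda>a. {\<eta> a})"
      using assms(4) PiE_singleton[of \<eta> A] by (simp add: PiE_iff)
    then show ?thesis using assms(3) by (simp add: sets_PiM_I_finite)
  qed
  ultimately have "(\<lambda>\<xi>. restrict \<xi> A) -` {\<eta>} \<inter> space P \<in> sets P"
    by (rule measurable_sets)
  then show ?thesis by (simp add: vimage_def Int_def conj_commute)
qed

text \<open>As \<open>A\<close> and the spin space are finite, the integrand is a finite combination
  of indicators of measurable cylinders, whatever \<open>g\<close> is.\<close>

lemma nn_integral_cylinder:
  fixes P :: "('v \<Rightarrow> 's::finite) measure"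
  assumes sP: "sets P = sets (\<Pi>\<^sub>M v\<in>V. count_space UNIV)" and A: "A \<subseteq> V" "finite A"
  shows "(\<integral>\<^sup>+ \<xi>. g (restrict \<xi> A) \<partial>P)
    = (\<Sum>\<eta>\<in>A \<rightarrow>\<^sub>E UNIV. g \<eta> * emeasure P {\<xi> \<in> space P. restrict \<xi> A = \<eta>})"
proof -
  let ?C = "\<lambda>\<eta>. {\<xi> \<in> space P. restrict \<xi> A = \<eta>}"
  have fin: "finite (A \<rightarrow>\<^sub>E (UNIV :: 's set))" using A by (simp add: finite_PiE)
  have "(\<integral>\<^sup>+ \<xi>. g (restrict \<xi> A) \<partial>P) = (\<integral>\<^sup>+ \<xi>. (\<Sum>\<eta>\<in>A \<rightarrow>\<^sub>E UNIV. g \<eta> * indicator (?C \<eta>) \<xi>) \<partial>P)"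
  proof (rule nn_integral_cong)
    fix \<xi> assume x: "\<xi> \<in> space P"
    have "(\<Sum>\<eta>\<in>A \<rightarrow>\<^sub>E UNIV. g \<eta> * indicator (?C \<eta>) \<xi>)
      = (\<Sum>\<eta>\<in>A \<rightarrow>\<^sub>E UNIV. of_bool (\<eta> = restrict \<xi> A) * g \<eta>)"
      using x by (intro sum.cong) (auto simp: indicator_def)
    also have "\<dots> = g (restrict \<xi> A)" by (rule sum_of_bool_eq_mult[OF fin]) auto
    finally show "g (restrict \<xi> A) = (\<Sum>\<eta>\<in>A \<rightarrow>\<^sub>E UNIV. g \<eta> * indicator (?C \<eta>) \<xi>)" by simp
  qed
  also have "\<dots> = (\<Sum>\<eta>\<in>A \<rightarrow>\<^sub>E UNIV. \<integral>\<^sup>+ \<xi>. g \<eta> * indicator (?C \<eta>) \<xi> \<partial>P)"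
    by (rule nn_integral_sum) (use cylinder_in_sets[OF sP A] in measurable)
  also have "\<dots> = (\<Sum>\<eta>\<in>A \<rightarrow>\<^sub>E UNIV. g \<eta> * emeasure P (?C \<eta>))"
    using cylinder_in_sets[OF sP A] by (intro sum.cong refl nn_integral_cmult_indicator)
  finally show ?thesis .
qed

text \<open>The cylinder over \<open>A\<close> is the disjoint union of those cylinders over
  \<open>C\<close> whose label restricts to \<open>\<eta>\<close>. This passes from the given
  marginals to marginals on boundary sets.\<close>

lemma measure_cylinder_marginal:
  fixes P :: "('v \<Rightarrow> 's::finite) measure"
  assumes "prob_space P" and sP: "sets P = sets (\<Pi>\<^sub>M v\<in>V. count_space UNIV)"
    and AC: "A \<subseteq> C" and C: "C \<subseteq> V" "finite C"
  shows "measure P {\<xi> \<in> space P. restrict \<xi> A = \<eta>}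
    = (\<Sum>\<sigma>\<in>C \<rightarrow>\<^sub>E UNIV. of_bool (restrict \<sigma> A = \<eta>) * measure P {\<xi> \<in> space P. restrict \<xi> C = \<sigma>})"
proof -
  interpret prob_space P by fact
  let ?S = "{\<sigma> \<in> C \<rightarrow>\<^sub>E (UNIV :: 's set). restrict \<sigma> A = \<eta>}"
  have fin: "finite (C \<rightarrow>\<^sub>E (UNIV :: 's set))" using C by (simp add: finite_PiE)
  have "{\<xi> \<in> space P. restrict \<xi> A = \<eta>} = (\<Union>\<sigma>\<in>?S. {\<xi> \<in> space P. restrict \<xi> C = \<sigma>})"
    using AC by (auto simp: inf.absorb2)
  also have "measure P \<dots> = (\<Sum>\<sigma>\<in>?S. measure P {\<xi> \<in> space P. restrict \<xi> C = \<sigma>})"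
    using fin cylinder_in_sets[OF sP C]
    by (intro finite_measure_finite_Union) (auto simp: disjoint_family_on_def)
  also have "\<dots> = (\<Sum>\<sigma>\<in>C \<rightarrow>\<^sub>E UNIV. if restrict \<sigma> A = \<eta> then measure P {\<xi> \<in> space P. restrict \<xi> C = \<sigma>} else 0)"
    using fin by (rule sum.inter_filter)
  finally show ?thesis by (simp add: of_bool_def if_distrib if_distribR cong: if_cong)
qed

section \<open>Rooted trees\<close>

context rooted_tree
begin

section \<open>Paths, depth and ancestors\<close>

lemma parent_unique: "(u, w) \<in> E \<Longrightarrow> (u', w) \<in> E \<Longrightarrow> u = u'"
  using unique_parent[of w] root_no_parent edges_in by blast

text \<open>Every step backwards is forced, so a vertex has at most one ancestor \<open>n\<close>
  generations up.\<close>

lemma relpow_source_unique: "(u, w) \<in> E ^^ n \<Longrightarrow> (u', w) \<in> E ^^ n \<Longrightarrow> u = u'"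
proof (induction n arbitrary: w)
  case (Suc n)
  then show ?case using parent_unique by (metis relpow_Suc_E)
qed simp

text \<open>Stripping last edges takes both paths back through the same vertices, and neither can
  reach the root before the other because the root has no parent.\<close>

lemma relpow_root_length_unique: "(r, w) \<in> E ^^ m \<Longrightarrow> (r, w) \<in> E ^^ n \<Longrightarrow> m = n"
proof (induction m arbitrary: n w)
  case 0
  then show ?case using root_no_parent by (cases n) auto
next
  case (Suc m)
  then obtain u where u: "(r, u) \<in> E ^^ m" "(u, w) \<in> E" by auto
  show ?case
  proof (cases n)
    case 0
    then show ?thesis using Suc.prems u root_no_parent by auto
  next
    case (Suc k)
    then obtain u' where "(r, u') \<in> E ^^ k" "(u', w) \<in> E" using \<open>(r, w) \<in> E ^^ n\<close> by auto
    then show ?thesis using u parent_unique[of u w u'] Suc.IH[of u k] Suc by simp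
  qed
qed

text \<open>All paths from the root to \<open>w\<close> have the same length, so the minimum in
  \<open>depth\<close> is over a single value.\<close>

lemma depth_eqI: "(r, w) \<in> E ^^ n \<Longrightarrow> depth r E w = n"
  unfolding depth_def
  using relpow_root_length_unique LeastI[of "\<lambda>n. (r, w) \<in> E ^^ n" n] by blast

lemma relpow_depth: "w \<in> V \<Longrightarrow> (r, w) \<in> E ^^ depth r E w"
  using reachable[of w] depth_eqI by (metis rtrancl_power)

lemma depth_root: "depth r E r = 0"
  by (rule depth_eqI) simp

lemma depth_add: "u \<in> V \<Longrightarrow> (u, w) \<in> E ^^ n \<Longrightarrow> depth r E w = depth r E u + n"
  using relpow_depth[of u] by (intro depth_eqI) (auto simp: relpow_add)

lemma depth_child: "(u, w) \<in> E \<Longrightarrow> depth r E w = Suc (depth r E u)"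
  using depth_add[of u w 1] edges_in by auto

lemma depth_mono: "u \<in> V \<Longrightarrow> (u, w) \<in> E\<^sup>* \<Longrightarrow> depth r E u \<le> depth r E w"
  using depth_add by (metis le_add1 rtrancl_power)

text \<open>Equal depths force the two paths down to \<open>w\<close> to have equal length, and
  ancestors at a given distance are unique. This is what separates the subtrees of siblings.\<close>

lemma ancestor_unique:
  assumes "u \<in> V" "u' \<in> V" "(u, w) \<in> E\<^sup>*" "(u', w) \<in> E\<^sup>*" "depth r E u = depth r E u'"
  shows "u = u'"
proof -
  obtain m n where m: "(u, w) \<in> E ^^ m" and n: "(u', w) \<in> E ^^ n"
    using assms by (auto simp: rtrancl_power)
  with assms have "m = n" using depth_add by (metis add_left_imp_eq)
  with m n show ?thesis using relpow_source_unique by blast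
qed

section \<open>Truncated subtrees and their boundaries\<close>

lemma subtree_boundary_subset: "subtree_boundary V r E N v \<subseteq> subtree V r E N v"
  by (auto simp: subtree_boundary_def)

lemma subtree_subset: "subtree V r E N v \<subseteq> V"
  by (auto simp: subtree_def)

lemma subtree_rec:
  assumes "v \<in> V" "depth r E v \<le> N"
  shows "subtree V r E N v = insert v (\<Union>w\<in>{w. (v, w) \<in> E}. subtree V r E N w)"
proof -
  have "(v, u) \<in> E\<^sup>* \<longleftrightarrow> v = u \<or> (\<exists>w. (v, w) \<in> E \<and> (w, u) \<in> E\<^sup>*)" for u
    by (meson converse_rtranclE converse_rtrancl_into_rtrancl rtrancl.rtrancl_refl)
  then show ?thesis using assms by (auto simp: subtree_def)
qed

text \<open>The strict inequality keeps \<open>v\<close> itself out of the boundary, so only the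
  parts below the children remain.\<close>

lemma subtree_boundary_rec:
  assumes "v \<in> V" "depth r E v < N"
  shows "subtree_boundary V r E N v = (\<Union>w\<in>{w. (v, w) \<in> E}. subtree_boundary V r E N w)"
  using subtree_rec[of v N] assms by (auto simp: subtree_boundary_def)

lemma subtree_disjoint: "disjoint_family_on (subtree V r E N) {w. (v, w) \<in> E}"
  unfolding disjoint_family_on_def
proof (intro ballI impI)
  fix w w' assume w: "w \<in> {w. (v, w) \<in> E}" "w' \<in> {w. (v, w) \<in> E}" "w \<noteq> w'"
  then have "depth r E w = depth r E w'" "w \<in> V" "w' \<in> V"
    using depth_child edges_in by auto
  then show "subtree V r E N w \<inter> subtree V r E N w' = {}"
    using w(3) ancestor_unique[of w w'] by (auto simp: subtree_def)
qed

lemma subtree_boundary_disjoint: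
  "disjoint_family_on (subtree_boundary V r E N) {w. (v, w) \<in> E}"
  using subtree_disjoint[of N v] subtree_boundary_subset[of N]
  unfolding disjoint_family_on_def by blast

lemma not_in_subtree_child: "(v, w) \<in> E \<Longrightarrow> v \<notin> subtree V r E N w"
  using depth_mono[of w v] depth_child[of v w] edges_in by (auto simp: subtree_def)

lemma subtree_leaf:
  assumes "v \<in> V" "depth r E v = N"
  shows "subtree V r E N v = {v}" "subtree_boundary V r E N v = {v}"
proof -
  have "subtree V r E N w = {}" if "(v, w) \<in> E" for w
    using that depth_child[OF that] depth_mono[of w] edges_in assms by (fastforce simp: subtree_def)
  then show "subtree V r E N v = {v}" using subtree_rec[of v N] assms by auto
  then show "subtree_boundary V r E N v = {v}" using assms by (auto simp: subtree_boundary_def)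
qed

text \<open>By induction each level of the tree is finite, and levels 0 to \<open>N\<close> cover
  the subtree.\<close>

lemma finite_subtree:
  assumes "\<And>u. u \<in> V \<Longrightarrow> finite {w. (u, w) \<in> E}"
  shows "finite (subtree V r E N v)"
proof -
  have "finite {w. (r, w) \<in> E ^^ n}" for n
  proof (induction n)
    case (Suc n)
    have "{w. (r, w) \<in> E ^^ Suc n} = (\<Union>u\<in>{u. (r, u) \<in> E ^^ n}. {w. (u, w) \<in> E})"
      by auto
    moreover have "finite {w. (u, w) \<in> E}" for u
    proof (cases "u \<in> V")
      case False
      then have "{w. (u, w) \<in> E} = {}" using edges_in by auto
      then show ?thesis by simp
    qed (rule assms)
    ultimately show ?case using Suc by simp
  qed simp
  moreover have "subtree V r E N v \<subseteq> (\<Union>n\<le>N. {w. (r, w) \<in> E ^^ n})"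
    using relpow_depth by (auto simp: subtree_def)
  ultimately show ?thesis by (meson finite_UN_I finite_atMost finite_subset)
qed

text \<open>An edge of the subtree either starts at \<open>v\<close> or starts below some child
  \<open>w\<close>; in the second case its endpoint is again a descendant of
  \<open>w\<close>.\<close>

lemma subtree_edges_rec:
  assumes "v \<in> V" "depth r E v < N"
  shows "E \<inter> subtree V r E N v \<times> subtree V r E N v =
    (\<Union>w\<in>{w. (v, w) \<in> E}. insert (v, w) (E \<inter> subtree V r E N w \<times> subtree V r E N w))"
    (is "?L = ?R")
proof
  have T: "subtree V r E N v = insert v (\<Union>w\<in>{w. (v, w) \<in> E}. subtree V r E N w)"
    using subtree_rec assms by simp
  have root: "w \<in> subtree V r E N w" if "(v, w) \<in> E" for w
    using that depth_child[OF that] assms edges_in by (auto simp: subtree_def)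
  show "?R \<subseteq> ?L" using T root by blast
  show "?L \<subseteq> ?R"
  proof
    fix e assume "e \<in> ?L"
    then obtain x y where e: "e = (x, y)" "(x, y) \<in> E" "x \<in> subtree V r E N v" "y \<in> subtree V r E N v"
      by auto
    show "e \<in> ?R"
    proof (cases "x = v")
      case False
      then obtain w where w: "(v, w) \<in> E" "x \<in> subtree V r E N w" using T e by auto
      then have "y \<in> subtree V r E N w" using e
        by (auto simp: subtree_def intro: rtrancl_into_rtrancl)
      then show ?thesis using w e by auto
    qed (use e in auto)
  qed
qed

end

section \<open>Likelihoods of boundary conditions\<close>

locale tree_chain = rooted_tree V r E
  for V :: "'v set" and r :: 'v and E :: "('v \<times> 'v) set" +
  fixes M :: "real ^ 's ^ 's" and \<alpha> :: "real ^ 's" and P :: "('v \<Rightarrow> 's) measure" and N :: nat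
  assumes M_stochastic: "stochastic_matrix M" and M_pos: "\<And>i j. M $ i $ j > 0"
    and \<alpha>_prob: "prob_vector \<alpha>" and \<alpha>_inv: "\<alpha> v* M = \<alpha>"
    and finite_children_V: "\<And>u. u \<in> V \<Longrightarrow> finite {w. (u, w) \<in> E}"
    and chain: "tree_markov_chain V r E \<alpha> M P"
begin

abbreviation "T \<equiv> subtree V r E N"
abbreviation "B \<equiv> subtree_boundary V r E N"
abbreviation "ch v \<equiv> {w. (v, w) \<in> E}"

text \<open>This is \<open>chain_weight\<close> without the initial factor: the conditional weight
  of a configuration on \<open>T v\<close> given its spin at \<open>v\<close>.\<close>

definition edge_weight :: "'v \<Rightarrow> ('v \<Rightarrow> 's) \<Rightarrow> real" where
  "edge_weight v \<sigma> = (\<Prod>(u, w)\<in>E \<inter> T v \<times> T v. M $ (\<sigma> u) $ (\<sigma> w))"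

text \<open>The constraints are \<open>of_bool\<close> factors rather than part of the index set, so
  that sums can be exchanged and factored over the children.\<close>

definition Z :: "'v \<Rightarrow> 's \<Rightarrow> ('v \<Rightarrow> 's) \<Rightarrow> real" where
  "Z v i \<xi> = (\<Sum>\<sigma>\<in>T v \<rightarrow>\<^sub>E UNIV. of_bool (\<sigma> v = i) * of_bool (\<forall>u\<in>B v. \<sigma> u = \<xi> u) * edge_weight v \<sigma>)"

definition Y :: "'v \<Rightarrow> 's \<Rightarrow> ('v \<Rightarrow> 's) \<Rightarrow> real" where
  "Y w i \<xi> = (\<Sum>j\<in>UNIV. M $ i $ j * Z w j \<xi>)"

text \<open>The probability of the boundary condition under the chain on \<open>T v\<close>, hence
  the normalising constant in Bayes' formula.\<close>

definition C :: "'v \<Rightarrow> ('v \<Rightarrow> 's) \<Rightarrow> real" where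
  "C v \<xi> = (\<Sum>i\<in>UNIV. \<alpha> $ i * Z v i \<xi>)"

lemma \<alpha>_pos: "\<alpha> $ i > 0"
  using invariant_vector_pos[OF \<alpha>_prob \<alpha>_inv M_pos] .

lemma sum_\<alpha>: "(\<Sum>i\<in>UNIV. \<alpha> $ i) = 1"
  using \<alpha>_prob by (simp add: prob_vector_def)

lemma sum_M: "(\<Sum>j\<in>UNIV. M $ i $ j) = 1"
  using M_stochastic by (simp add: stochastic_matrix_def prob_vector_def)

lemma sum_\<alpha>_M: "(\<Sum>i\<in>UNIV. \<alpha> $ i * M $ i $ j) = \<alpha> $ j"
  using arg_cong[OF \<alpha>_inv, of "\<lambda>x. x $ j"] by (simp add: vector_matrix_mult_def mult.commute)

lemma finite_children: "finite (ch v)"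
proof (cases "v \<in> V")
  case False
  then have "ch v = {}" using edges_in by auto
  then show ?thesis by simp
qed (rule finite_children_V)

lemma finite_T: "finite (T v)"
  using finite_subtree finite_children_V by blast

lemma finite_B: "finite (B v)"
  by (rule finite_subset[OF subtree_boundary_subset finite_T])

lemma finite_configs: "finite A \<Longrightarrow> finite (A \<rightarrow>\<^sub>E (UNIV :: 's set))"
  by (simp add: finite_PiE)

lemma B_subset_V: "B v \<subseteq> V"
  using subtree_boundary_subset subtree_subset by blast

text \<open>Locality in the boundary spins, here and in the next two lemmas, is what reduces
  integrals over \<open>P\<close> to finite sums over \<open>B v\<close>.\<close>

lemma Z_cong: "(\<And>u. u \<in> B v \<Longrightarrow> \<xi> u = \<xi>' u) \<Longrightarrow> Z v i \<xi> = Z v i \<xi>'"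
  by (simp add: Z_def)

lemma Y_cong: "(\<And>u. u \<in> B v \<Longrightarrow> \<xi> u = \<xi>' u) \<Longrightarrow> Y v i \<xi> = Y v i \<xi>'"
  unfolding Y_def by (intro sum.cong refl arg_cong2[where f = "(*)"] Z_cong)

lemma C_cong: "(\<And>u. u \<in> B v \<Longrightarrow> \<xi> u = \<xi>' u) \<Longrightarrow> C v \<xi> = C v \<xi>'"
  unfolding C_def by (intro sum.cong refl arg_cong2[where f = "(*)"] Z_cong)

section \<open>Recursion over the children of a vertex\<close>

lemma edge_weight_pos: "edge_weight v \<sigma> > 0"
  unfolding edge_weight_def by (intro prod_pos) (auto simp: M_pos)

lemma edge_weight_cong: "(\<And>u. u \<in> T v \<Longrightarrow> \<sigma> u = \<sigma>' u) \<Longrightarrow> edge_weight v \<sigma> = edge_weight v \<sigma>'"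
  unfolding edge_weight_def by (intro prod.cong) auto

lemma edge_weight_rec:
  assumes "v \<in> V" "depth r E v < N"
  shows "edge_weight v \<sigma> = (\<Prod>w\<in>ch v. M $ (\<sigma> v) $ (\<sigma> w) * edge_weight w \<sigma>)"
proof -
  let ?F = "\<lambda>w. insert (v, w) (E \<inter> T w \<times> T w)"
  have fin: "finite (E \<inter> T w \<times> T w)" for w
    using finite_T by (simp add: finite_Int)
  have v: "v \<notin> T w" if "w \<in> ch v" for w
    using not_in_subtree_child that by blast
  \<comment> \<open>Edges from \<open>v\<close> to distinct children differ, no edge at
    \<open>v\<close> lies in a child's subtree because \<open>v\<close> does not, and the subtrees
    of distinct children are disjoint.\<close>
  have dj: "?F w \<inter> ?F w' = {}" if "w \<in> ch v" "w' \<in> ch v" "w \<noteq> w'" for w w'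
    using subtree_disjoint[of N v] that v unfolding disjoint_family_on_def by blast
  have "edge_weight v \<sigma> = (\<Prod>(u, w)\<in>(\<Union>w\<in>ch v. ?F w). M $ (\<sigma> u) $ (\<sigma> w))"
    unfolding edge_weight_def using subtree_edges_rec[OF assms] by simp
  also have "\<dots> = (\<Prod>w\<in>ch v. \<Prod>(u, w)\<in>?F w. M $ (\<sigma> u) $ (\<sigma> w))"
    using finite_children fin dj by (intro prod.UNION_disjoint) auto
  also have "\<dots> = (\<Prod>w\<in>ch v. M $ (\<sigma> v) $ (\<sigma> w) * edge_weight w \<sigma>)"
    using fin v by (intro prod.cong refl) (auto simp: edge_weight_def)
  finally show ?thesis .
qed

text \<open>The sum over the spin of \<open>w\<close> is absorbed into the sum over configurations
  on \<open>T w\<close>, since each configuration carries exactly one spin at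
  \<open>w\<close>.\<close>

lemma Y_alt:
  "Y w i \<xi> = (\<Sum>\<sigma>\<in>T w \<rightarrow>\<^sub>E UNIV.
     of_bool (\<forall>u\<in>B w. \<sigma> u = \<xi> u) * (M $ i $ (\<sigma> w) * edge_weight w \<sigma>))"
proof -
  have "Y w i \<xi> = (\<Sum>\<sigma>\<in>T w \<rightarrow>\<^sub>E UNIV. \<Sum>j\<in>UNIV. of_bool (j = \<sigma> w) *
      (M $ i $ j * (of_bool (\<forall>u\<in>B w. \<sigma> u = \<xi> u) * edge_weight w \<sigma>)))"
    unfolding Y_def Z_def sum_distrib_left by (subst sum.swap, intro sum.cong refl) auto
  also have "\<dots> = (\<Sum>\<sigma>\<in>T w \<rightarrow>\<^sub>E UNIV.
     of_bool (\<forall>u\<in>B w. \<sigma> u = \<xi> u) * (M $ i $ (\<sigma> w) * edge_weight w \<sigma>))"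
    by (intro sum.cong refl, subst sum_of_bool_eq_mult) auto
  finally show ?thesis .
qed

text \<open>Given the spin at \<open>v\<close> the branches are independent: once that spin is split
  off, the edge weights and the boundary indicator both factor over the children.\<close>

lemma Z_rec:
  assumes v: "v \<in> V" "depth r E v < N"
  shows "Z v i \<xi> = (\<Prod>w\<in>ch v. Y w i \<xi>)"
proof -
  let ?D = "\<Union>w\<in>ch v. T w"
  let ?f = "\<lambda>w \<sigma>. of_bool (\<forall>u\<in>B w. \<sigma> u = \<xi> u) * (M $ i $ (\<sigma> w) * edge_weight w \<sigma>)"
  have vD: "v \<notin> ?D" using not_in_subtree_child by blast
  have finD: "finite ?D" using finite_children finite_T by blast
  have root: "w \<in> T w" if "w \<in> ch v" for w
    using that depth_child[of v w] v edges_in by (auto simp: subtree_def)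
  have TD: "T v = insert v ?D" using subtree_rec v by simp
  have bd: "B v = (\<Union>w\<in>ch v. B w)" using subtree_boundary_rec v by simp
  have "Z v i \<xi> = (\<Sum>s\<in>UNIV. \<Sum>\<tau>\<in>?D \<rightarrow>\<^sub>E UNIV. of_bool (s = i) *
     (of_bool (\<forall>u\<in>B v. (\<tau>(v := s)) u = \<xi> u) * edge_weight v (\<tau>(v := s))))"
    unfolding Z_def TD by (subst sum_PiE_insert[OF finD vD]) (simp_all add: mult.assoc)
  also have "\<dots> = (\<Sum>s\<in>UNIV. of_bool (s = i) * (\<Sum>\<tau>\<in>?D \<rightarrow>\<^sub>E UNIV.
     (of_bool (\<forall>u\<in>B v. (\<tau>(v := s)) u = \<xi> u) * edge_weight v (\<tau>(v := s)))))"
    by (simp add: sum_distrib_left)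
  also have "\<dots> = (\<Sum>\<tau>\<in>?D \<rightarrow>\<^sub>E UNIV.
      of_bool (\<forall>u\<in>B v. (\<tau>(v := i)) u = \<xi> u) * edge_weight v (\<tau>(v := i)))"
    by (rule sum_of_bool_eq_mult) auto
  also have "\<dots> = (\<Sum>\<tau>\<in>?D \<rightarrow>\<^sub>E UNIV. \<Prod>w\<in>ch v. ?f w (restrict \<tau> (T w)))"
  proof (intro sum.cong refl)
    fix \<tau> :: "'v \<Rightarrow> 's"
    have "of_bool (\<forall>u\<in>B v. (\<tau>(v := i)) u = \<xi> u)
       = (\<Prod>w\<in>ch v. of_bool (\<forall>u\<in>B w. (\<tau>(v := i)) u = \<xi> u) :: real)"
      using finite_children bd by (simp add: prod_of_bool)
    then have "of_bool (\<forall>u\<in>B v. (\<tau>(v := i)) u = \<xi> u) * edge_weight v (\<tau>(v := i))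
       = (\<Prod>w\<in>ch v. of_bool (\<forall>u\<in>B w. (\<tau>(v := i)) u = \<xi> u) *
            (M $ i $ ((\<tau>(v := i)) w) * edge_weight w (\<tau>(v := i))))"
      by (simp add: edge_weight_rec[OF v] prod.distrib)
    also have "\<dots> = (\<Prod>w\<in>ch v. ?f w (restrict \<tau> (T w)))"
    proof (rule prod.cong[OF refl])
      fix w assume w: "w \<in> ch v"
      \<comment> \<open>The spin inserted at \<open>v\<close> is invisible inside the subtree of a
        child, as \<open>v\<close> does not belong to it.\<close>
      have eq: "(\<tau>(v := i)) u = restrict \<tau> (T w) u" if "u \<in> T w" for u
        using that w not_in_subtree_child by auto
      have "(\<forall>u\<in>B w. (\<tau>(v := i)) u = \<xi> u) \<longleftrightarrow> (\<forall>u\<in>B w. restrict \<tau> (T w) u = \<xi> u)"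
        using eq subtree_boundary_subset by (metis subsetD)
      moreover have "edge_weight w (\<tau>(v := i)) = edge_weight w (restrict \<tau> (T w))"
        using eq by (rule edge_weight_cong)
      moreover note eq[OF root[OF w]]
      ultimately show "of_bool (\<forall>u\<in>B w. (\<tau>(v := i)) u = \<xi> u) *
            (M $ i $ ((\<tau>(v := i)) w) * edge_weight w (\<tau>(v := i))) = ?f w (restrict \<tau> (T w))"
        by presburger
    qed
    finally show "of_bool (\<forall>u\<in>B v. (\<tau>(v := i)) u = \<xi> u) * edge_weight v (\<tau>(v := i)) =
       (\<Prod>w\<in>ch v. ?f w (restrict \<tau> (T w)))" .
  qed
  also have "\<dots> = (\<Prod>w\<in>ch v. \<Sum>\<tau>\<in>T w \<rightarrow>\<^sub>E UNIV. ?f w \<tau>)"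
    using finite_children finite_T subtree_disjoint by (intro sum_PiE_UN) auto
  also have "\<dots> = (\<Prod>w\<in>ch v. Y w i \<xi>)"
    by (simp add: Y_alt)
  finally show ?thesis .
qed

lemma Z_leaf:
  assumes "v \<in> V" "depth r E v = N"
  shows "Z v i \<xi> = of_bool (\<xi> v = i)"
proof -
  \<comment> \<open>A loop would make the depth of \<open>v\<close> exceed itself.\<close>
  have "E \<inter> {v} \<times> {v} = {}" using depth_child[of v v] by auto
  then have "Z v i \<xi> = (\<Sum>\<sigma>\<in>{v} \<rightarrow>\<^sub>E UNIV. of_bool (\<sigma> v = i) * of_bool (\<sigma> v = \<xi> v))"
    by (simp add: Z_def subtree_leaf[OF assms] edge_weight_def)
  also have "\<dots> = (\<Sum>s\<in>UNIV. of_bool (s = i) * of_bool (s = \<xi> v))"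
    by (subst sum_PiE_insert) auto
  also have "\<dots> = of_bool (i = \<xi> v)"
    by (rule sum_of_bool_eq_mult) auto
  finally show ?thesis by (simp add: eq_commute)
qed

section \<open>Positivity of the likelihoods\<close>

lemma Z_nonneg: "Z v i \<xi> \<ge> 0"
  unfolding Z_def by (intro sum_nonneg) (auto simp: edge_weight_pos less_imp_le)

text \<open>The restriction of \<open>\<xi>\<close> to \<open>T v\<close> is itself an admissible
  configuration of positive weight. Only the spin \<open>\<xi> v\<close> is covered because on level
  \<open>N\<close> the likelihood is a point mass.\<close>

lemma Z_pos_self:
  assumes "v \<in> V" "depth r E v \<le> N"
  shows "Z v (\<xi> v) \<xi> > 0"
proof -
  have "v \<in> T v" using assms by (auto simp: subtree_def)
  then show ?thesis unfolding Z_def using subtree_boundary_subset[of N v]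
    by (intro sum_pos2[of _ "restrict \<xi> (T v)"])
       (auto simp: edge_weight_pos less_imp_le finite_configs finite_T)
qed

text \<open>Positive entries of \<open>M\<close> spread the mass at one spin of \<open>w\<close> to
  all spins of the parent, also when \<open>w\<close> lies on level \<open>N\<close>. This keeps
  every logarithm below finite.\<close>

lemma Y_pos:
  assumes "(v, w) \<in> E" "depth r E v < N"
  shows "Y w i \<xi> > 0"
proof -
  have "Z w (\<xi> w) \<xi> > 0"
    using assms edges_in depth_child[of v w] by (intro Z_pos_self) auto
  then show ?thesis unfolding Y_def using M_pos Z_nonneg
    by (intro sum_pos2[of _ "\<xi> w"]) (auto simp: less_imp_le)
qed

lemma Z_pos: "v \<in> V \<Longrightarrow> depth r E v < N \<Longrightarrow> Z v i \<xi> > 0"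
  using Y_pos by (auto simp: Z_rec intro!: prod_pos)

lemma C_pos:
  assumes "v \<in> V" "depth r E v \<le> N"
  shows "C v \<xi> > 0"
  unfolding C_def using \<alpha>_pos Z_nonneg Z_pos_self[OF assms]
  by (intro sum_pos2[of _ "\<xi> v"]) (auto simp: less_imp_le)

text \<open>This is where the invariance of \<open>\<alpha>\<close> enters.\<close>

lemma C_eq_sum_Y: "C w \<xi> = (\<Sum>i\<in>UNIV. \<alpha> $ i * Y w i \<xi>)"
proof -
  have "(\<Sum>i\<in>UNIV. \<alpha> $ i * Y w i \<xi>) = (\<Sum>j\<in>UNIV. \<Sum>i\<in>UNIV. \<alpha> $ i * M $ i $ j * Z w j \<xi>)"
    unfolding Y_def sum_distrib_left by (subst sum.swap) (simp add: mult.assoc)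
  also have "\<dots> = C w \<xi>"
    by (simp add: C_def flip: sum_distrib_right) (simp add: sum_\<alpha>_M)
  finally show ?thesis by simp
qed

section \<open>Summation over boundary spins\<close>

text \<open>The functions \<open>F w\<close> serve as test functions: taking all of them to be 1
  yields normalisation, and all but one yields a marginal.\<close>

lemma sum_boundary_prod:
  assumes "v \<in> V" "depth r E v < N"
  shows "(\<Sum>\<eta>\<in>B v \<rightarrow>\<^sub>E UNIV. Z v i \<eta> * (\<Prod>w\<in>ch v. F w (restrict \<eta> (B w))))
    = (\<Prod>w\<in>ch v. \<Sum>\<eta>\<in>B w \<rightarrow>\<^sub>E UNIV. Y w i \<eta> * F w \<eta>)"
proof -
  have "Z v i \<eta> * (\<Prod>w\<in>ch v. F w (restrict \<eta> (B w)))
      = (\<Prod>w\<in>ch v. Y w i (restrict \<eta> (B w)) * F w (restrict \<eta> (B w)))" for \<eta>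
  proof -
    have "Y w i \<eta> = Y w i (restrict \<eta> (B w))" for w by (rule Y_cong) simp
    then show ?thesis by (simp add: Z_rec[OF assms] prod.distrib)
  qed
  then show ?thesis
    unfolding subtree_boundary_rec[OF assms]
    using sum_PiE_UN[where f = "\<lambda>w \<eta>. Y w i \<eta> * F w \<eta>" and A = B and W = "ch v" and S = "\<lambda>_. UNIV"]
      finite_children finite_B subtree_boundary_disjoint by simp
qed

text \<open>Holds because the rows of \<open>M\<close> sum to 1. Normalisation of \<open>Z w\<close>
  is a hypothesis so that the lemma can serve inside the induction that proves it.\<close>

lemma sum_Y_eq_1:
  assumes "\<And>j. (\<Sum>\<eta>\<in>B w \<rightarrow>\<^sub>E UNIV. Z w j \<eta>) = 1"
  shows "(\<Sum>\<eta>\<in>B w \<rightarrow>\<^sub>E UNIV. Y w i \<eta>) = 1"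
proof -
  have "(\<Sum>\<eta>\<in>B w \<rightarrow>\<^sub>E UNIV. Y w i \<eta>) = (\<Sum>j\<in>UNIV. M $ i $ j * (\<Sum>\<eta>\<in>B w \<rightarrow>\<^sub>E UNIV. Z w j \<eta>))"
    unfolding Y_def sum_distrib_left by (rule sum.swap)
  then show ?thesis by (simp add: assms sum_M)
qed

text \<open>For fixed \<open>i\<close> the likelihood is a probability law on boundary conditions.
  The induction climbs from level \<open>N\<close> towards the root.\<close>

lemma sum_Z:
  assumes "v \<in> V" "depth r E v \<le> N"
  shows "(\<Sum>\<eta>\<in>B v \<rightarrow>\<^sub>E UNIV. Z v i \<eta>) = 1"
  using assms
proof (induction "N - depth r E v" arbitrary: v i)
  case 0
  then have "depth r E v = N" by simp
  note leaf = subtree_leaf[OF 0(2) this] Z_leaf[OF 0(2) this]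
  have "(\<Sum>\<eta>\<in>B v \<rightarrow>\<^sub>E UNIV. Z v i \<eta>) = (\<Sum>s\<in>UNIV. of_bool (s = i) * 1)"
    unfolding leaf by (subst sum_PiE_insert) auto
  also have "\<dots> = 1" by (rule sum_of_bool_eq_mult) auto
  finally show ?case .
next
  case (Suc n)
  then have v: "depth r E v < N" by simp
  have "(\<Sum>\<eta>\<in>B w \<rightarrow>\<^sub>E UNIV. Y w i \<eta>) = 1" if "w \<in> ch v" for w
    using that depth_child[of v w] edges_in Suc by (intro sum_Y_eq_1 Suc(1)) auto
  then show ?case
    using sum_boundary_prod[OF Suc(3) v, of i "\<lambda>_ _. 1"] by simp
qed

text \<open>The siblings of \<open>w\<close> each contribute total mass 1, which leaves the law
  \<open>Y w i\<close> on the boundary below \<open>w\<close>.\<close>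

lemma sum_Z_marginal:
  assumes v: "v \<in> V" "depth r E v < N" and w: "(v, w) \<in> E"
  shows "(\<Sum>\<eta>\<in>B v \<rightarrow>\<^sub>E UNIV. Z v i \<eta> * F (restrict \<eta> (B w))) = (\<Sum>\<eta>\<in>B w \<rightarrow>\<^sub>E UNIV. Y w i \<eta> * F \<eta>)"
proof -
  let ?F = "\<lambda>u \<eta>. if u = w then F \<eta> else 1"
  have one: "(\<Sum>\<eta>\<in>B u \<rightarrow>\<^sub>E UNIV. Y u i \<eta>) = 1" if "u \<in> ch v" for u
    using that depth_child[of v u] edges_in v by (intro sum_Y_eq_1 sum_Z) auto
  have "(\<Prod>u\<in>ch v. ?F u (restrict \<eta> (B u))) = F (restrict \<eta> (B w))" for \<eta>
    using w finite_children by (simp add: prod.delta)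
  then have "(\<Sum>\<eta>\<in>B v \<rightarrow>\<^sub>E UNIV. Z v i \<eta> * F (restrict \<eta> (B w)))
     = (\<Prod>u\<in>ch v. \<Sum>\<eta>\<in>B u \<rightarrow>\<^sub>E UNIV. Y u i \<eta> * ?F u \<eta>)"
    using sum_boundary_prod[OF v, of i ?F] by simp
  also have "\<dots> = (\<Prod>u\<in>ch v. if u = w then \<Sum>\<eta>\<in>B w \<rightarrow>\<^sub>E UNIV. Y w i \<eta> * F \<eta> else 1)"
    using one by (intro prod.cong refl) auto
  also have "\<dots> = (\<Sum>\<eta>\<in>B w \<rightarrow>\<^sub>E UNIV. Y w i \<eta> * F \<eta>)"
    using w finite_children by (simp add: prod.delta)
  finally show ?thesis .
qed

text \<open>This averages the previous marginal over \<open>i\<close> with weights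
  \<open>\<alpha>\<close>; by invariance the mixture of the laws \<open>Y w i\<close> is again
  \<open>C w\<close>.\<close>

lemma sum_C_marginal:
  assumes v: "v \<in> V" "depth r E v < N" and w: "(v, w) \<in> E"
  shows "(\<Sum>\<eta>\<in>B v \<rightarrow>\<^sub>E UNIV. C v \<eta> * F (restrict \<eta> (B w))) = (\<Sum>\<eta>\<in>B w \<rightarrow>\<^sub>E UNIV. C w \<eta> * F \<eta>)"
proof -
  have "(\<Sum>\<eta>\<in>B v \<rightarrow>\<^sub>E UNIV. C v \<eta> * F (restrict \<eta> (B w)))
    = (\<Sum>i\<in>UNIV. \<alpha> $ i * (\<Sum>\<eta>\<in>B v \<rightarrow>\<^sub>E UNIV. Z v i \<eta> * F (restrict \<eta> (B w))))"
    unfolding C_def sum_distrib_left sum_distrib_right by (subst sum.swap) (simp add: mult.assoc)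
  also have "\<dots> = (\<Sum>\<eta>\<in>B w \<rightarrow>\<^sub>E UNIV. C w \<eta> * F \<eta>)"
    unfolding sum_Z_marginal[OF assms] C_eq_sum_Y sum_distrib_left sum_distrib_right
    by (subst sum.swap) (simp add: mult.assoc)
  finally show ?thesis .
qed

section \<open>The law of the boundary spins and the conditioned root law\<close>

lemma prob_space_P: "prob_space P"
  and sets_P: "sets P = sets (\<Pi>\<^sub>M v\<in>V. count_space UNIV)"
  and measure_P: "\<sigma> \<in> T r \<rightarrow>\<^sub>E UNIV \<Longrightarrow>
    measure P {\<tau> \<in> space P. restrict \<tau> (T r) = \<sigma>} = \<alpha> $ (\<sigma> r) * edge_weight r \<sigma>"
  using chain by (auto simp: tree_markov_chain_def chain_weight_def edge_weight_def)

text \<open>The numerator of Bayes' formula; the next lemma supplies the denominator.\<close>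

lemma sum_chain_weight:
  "(\<Sum>\<sigma>\<in>T v \<rightarrow>\<^sub>E UNIV. of_bool (\<sigma> v = i) * of_bool (\<forall>u\<in>B v. \<sigma> u = \<xi> u) *
     (\<alpha> $ (\<sigma> v) * edge_weight v \<sigma>)) = \<alpha> $ i * Z v i \<xi>"
  unfolding Z_def sum_distrib_left by (intro sum.cong) auto

lemma sum_chain_weight_UNIV:
  "(\<Sum>\<sigma>\<in>T v \<rightarrow>\<^sub>E UNIV. of_bool (\<forall>u\<in>B v. \<sigma> u = \<xi> u) * (\<alpha> $ (\<sigma> v) * edge_weight v \<sigma>)) = C v \<xi>"
proof -
  have "C v \<xi> = (\<Sum>\<sigma>\<in>T v \<rightarrow>\<^sub>E UNIV. \<Sum>i\<in>UNIV. of_bool (i = \<sigma> v) *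
     (of_bool (\<forall>u\<in>B v. \<sigma> u = \<xi> u) * (\<alpha> $ (\<sigma> v) * edge_weight v \<sigma>)))"
    unfolding C_def sum_chain_weight[symmetric] by (subst sum.swap) (simp add: mult.assoc eq_commute)
  also have "\<dots> = (\<Sum>\<sigma>\<in>T v \<rightarrow>\<^sub>E UNIV.
      of_bool (\<forall>u\<in>B v. \<sigma> u = \<xi> u) * (\<alpha> $ (\<sigma> v) * edge_weight v \<sigma>))"
    by (intro sum.cong refl, subst sum_of_bool_eq_mult) auto
  finally show ?thesis by simp
qed

text \<open>In equilibrium the chain on the whole tree and the chain on \<open>T v\<close> give the
  same law to the boundary spins. At the root this comes from the prescribed marginal, and
  \<open>sum_C_marginal\<close> passes it from a parent to its child.\<close>

lemma measure_boundary:
  assumes "v \<in> V" "depth r E v \<le> N" "\<eta> \<in> B v \<rightarrow>\<^sub>E UNIV"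
  shows "measure P {\<xi> \<in> space P. restrict \<xi> (B v) = \<eta>} = C v \<eta>"
  using assms
proof (induction "depth r E v" arbitrary: v \<eta>)
  case 0
  then have v: "v = r" using relpow_depth[of v] by simp
  have "measure P {\<xi> \<in> space P. restrict \<xi> (B r) = \<eta>}
    = (\<Sum>\<sigma>\<in>T r \<rightarrow>\<^sub>E UNIV. of_bool (restrict \<sigma> (B r) = \<eta>) * (\<alpha> $ (\<sigma> r) * edge_weight r \<sigma>))"
    by (subst measure_cylinder_marginal[OF prob_space_P sets_P subtree_boundary_subset
          subtree_subset finite_T]) (simp add: measure_P)
  also have "\<dots> = (\<Sum>\<sigma>\<in>T r \<rightarrow>\<^sub>E UNIV.
      of_bool (\<forall>u\<in>B r. \<sigma> u = \<eta> u) * (\<alpha> $ (\<sigma> r) * edge_weight r \<sigma>))"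
  proof (intro sum.cong refl)
    fix \<sigma> :: "'v \<Rightarrow> 's"
    \<comment> \<open>As \<open>\<eta>\<close> is extensional, both functions are
      \<open>undefined\<close> off \<open>B r\<close>, and only the values on \<open>B r\<close>
      have to be compared.\<close>
    have "restrict \<sigma> (B r) = \<eta> \<longleftrightarrow> (\<forall>u\<in>B r. \<sigma> u = \<eta> u)"
      using 0(4) v by (auto simp: fun_eq_iff PiE_def extensional_def)
    then show "of_bool (restrict \<sigma> (B r) = \<eta>) * (\<alpha> $ (\<sigma> r) * edge_weight r \<sigma>)
       = of_bool (\<forall>u\<in>B r. \<sigma> u = \<eta> u) * (\<alpha> $ (\<sigma> r) * edge_weight r \<sigma>)" by simp
  qed
  also have "\<dots> = C r \<eta>" by (rule sum_chain_weight_UNIV)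
  finally show ?case unfolding v .
next
  case (Suc n)
  then have "v \<noteq> r" using depth_root by auto
  then obtain u where u: "(u, v) \<in> E" using unique_parent Suc by blast
  then have uV: "u \<in> V" "depth r E u < N" "n = depth r E u"
    using edges_in depth_child[OF u] Suc by auto
  have "B v \<subseteq> B u" using subtree_boundary_rec[of u N] uV u by blast
  then have "measure P {\<xi> \<in> space P. restrict \<xi> (B v) = \<eta>} = (\<Sum>\<sigma>\<in>B u \<rightarrow>\<^sub>E UNIV.
      of_bool (restrict \<sigma> (B v) = \<eta>) * measure P {\<xi> \<in> space P. restrict \<xi> (B u) = \<sigma>})"
    by (rule measure_cylinder_marginal[OF prob_space_P sets_P _ B_subset_V finite_B])
  also have "\<dots> = (\<Sum>\<sigma>\<in>B u \<rightarrow>\<^sub>E UNIV. C u \<sigma> * of_bool (restrict \<sigma> (B v) = \<eta>))"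
    using uV by (intro sum.cong refl) (simp add: Suc(1))
  also have "\<dots> = (\<Sum>\<sigma>\<in>B v \<rightarrow>\<^sub>E UNIV. C v \<sigma> * of_bool (\<sigma> = \<eta>))"
    by (rule sum_C_marginal[OF uV(1,2) u])
  also have "\<dots> = (\<Sum>\<sigma>\<in>B v \<rightarrow>\<^sub>E UNIV. of_bool (\<sigma> = \<eta>) * C v \<sigma>)"
    by (simp add: mult.commute)
  also have "\<dots> = C v \<eta>"
    by (rule sum_of_bool_eq_mult[OF finite_configs[OF finite_B]]) fact
  finally show ?case .
qed

lemma nn_integral_boundary:
  assumes "v \<in> V" "depth r E v \<le> N"
    and "\<And>\<xi>. g \<xi> = g (restrict \<xi> (B v))" and "\<And>\<xi>. 0 \<le> g \<xi>"
  shows "(\<integral>\<^sup>+ \<xi>. ennreal (g \<xi>) \<partial>P) = ennreal (\<Sum>\<eta>\<in>B v \<rightarrow>\<^sub>E UNIV. C v \<eta> * g \<eta>)"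
proof -
  interpret prob_space P by (rule prob_space_P)
  have "(\<integral>\<^sup>+ \<xi>. ennreal (g \<xi>) \<partial>P) = (\<integral>\<^sup>+ \<xi>. ennreal (g (restrict \<xi> (B v))) \<partial>P)"
    by (intro nn_integral_cong arg_cong[where f = ennreal] assms(3))
  also have "\<dots> = (\<Sum>\<eta>\<in>B v \<rightarrow>\<^sub>E UNIV. ennreal (g \<eta>) * emeasure P {\<xi> \<in> space P. restrict \<xi> (B v) = \<eta>})"
    by (rule nn_integral_cylinder[OF sets_P B_subset_V finite_B])
  also have "\<dots> = (\<Sum>\<eta>\<in>B v \<rightarrow>\<^sub>E UNIV. ennreal (C v \<eta> * g \<eta>))"
    using assms(1,2,4) C_pos[OF assms(1,2)]
    by (intro sum.cong refl)
      (simp add: emeasure_eq_measure measure_boundary ennreal_mult less_imp_le mult.commute)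
  also have "\<dots> = ennreal (\<Sum>\<eta>\<in>B v \<rightarrow>\<^sub>E UNIV. C v \<eta> * g \<eta>)"
    using assms(4) C_pos[OF assms(1,2)] by (intro sum_ennreal) (simp add: less_imp_le)
  finally show ?thesis .
qed

text \<open>Bayes' formula: the prior \<open>\<alpha>\<close> times the likelihood
  \<open>Z v\<close>, divided by the probability \<open>C v\<close> of the boundary condition, which
  is positive.\<close>

lemma root_law_eq:
  assumes "v \<in> V" "depth r E v \<le> N"
  shows "root_law V r E \<alpha> M N \<xi> v = (\<chi> i. \<alpha> $ i * Z v i \<xi> / C v \<xi>)"
proof (rule vec_eq_iff[THEN iffD2, rule_format])
  fix i
  let ?Q = "subtree_chain V r E \<alpha> M N v"
  let ?X = "T v \<rightarrow>\<^sub>E (UNIV :: 's set)"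
  let ?A = "{\<sigma> \<in> ?X. \<forall>w\<in>B v. \<sigma> w = \<xi> w}"
  let ?S = "{\<sigma> \<in> ?X. \<sigma> v = i}"
  let ?h = "\<lambda>\<sigma>. \<alpha> $ (\<sigma> v) * edge_weight v \<sigma>"
  have fin: "finite ?X" by (simp add: finite_configs finite_T)
  have h0: "?h \<sigma> \<ge> 0" for \<sigma> using \<alpha>_pos edge_weight_pos by (simp add: less_imp_le)
  have Q: "?Q = point_measure ?X (\<lambda>\<sigma>. ennreal (?h \<sigma>))"
    by (simp add: subtree_chain_def chain_weight_def edge_weight_def)
  have sp: "space ?Q = ?X" and st: "sets ?Q = Pow ?X"
    by (simp_all add: Q space_point_measure sets_point_measure)
  have em: "emeasure ?Q K = ennreal (\<Sum>\<sigma>\<in>K. ?h \<sigma>)" if "K \<subseteq> ?X" for K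
    unfolding Q using that fin h0 by (simp add: emeasure_point_measure_finite sum_ennreal)
  have A: "(\<Sum>\<sigma>\<in>?A. ?h \<sigma>) = C v \<xi>"
  proof -
    have "(\<Sum>\<sigma>\<in>?A. ?h \<sigma>) = (\<Sum>\<sigma>\<in>?X. if \<forall>w\<in>B v. \<sigma> w = \<xi> w then ?h \<sigma> else 0)"
      using fin by (rule sum.inter_filter)
    also have "\<dots> = C v \<xi>"
      unfolding sum_chain_weight_UNIV[symmetric] by (intro sum.cong) auto
    finally show ?thesis .
  qed
  have AS: "(\<Sum>\<sigma>\<in>?A \<inter> ?S. ?h \<sigma>) = \<alpha> $ i * Z v i \<xi>"
  proof -
    have "?A \<inter> ?S = {\<sigma> \<in> ?X. \<sigma> v = i \<and> (\<forall>w\<in>B v. \<sigma> w = \<xi> w)}" by auto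
    then have "(\<Sum>\<sigma>\<in>?A \<inter> ?S. ?h \<sigma>)
        = (\<Sum>\<sigma>\<in>?X. if \<sigma> v = i \<and> (\<forall>w\<in>B v. \<sigma> w = \<xi> w) then ?h \<sigma> else 0)"
      using fin by (simp only: sum.inter_filter)
    also have "\<dots> = \<alpha> $ i * Z v i \<xi>"
      unfolding sum_chain_weight[symmetric] by (intro sum.cong) auto
    finally show ?thesis .
  qed
  have Cp: "C v \<xi> > 0" using C_pos assms by simp
  have "emeasure (uniform_measure ?Q ?A) ?S = emeasure ?Q (?A \<inter> ?S) / emeasure ?Q ?A"
    by (rule emeasure_uniform_measure) (auto simp: st)
  also have "\<dots> = ennreal (\<alpha> $ i * Z v i \<xi>) / ennreal (C v \<xi>)"
    unfolding A[symmetric] AS[symmetric] by (intro arg_cong2[where f = "(/)"] em) blast+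
  also have "\<dots> = ennreal (\<alpha> $ i * Z v i \<xi> / C v \<xi>)"
    using Cp \<alpha>_pos Z_nonneg by (intro divide_ennreal) (auto simp: less_imp_le)
  finally have "measure (uniform_measure ?Q ?A) ?S = \<alpha> $ i * Z v i \<xi> / C v \<xi>"
    using Cp \<alpha>_pos[of i] Z_nonneg by (simp add: measure_def less_imp_le)
  then show "root_law V r E \<alpha> M N \<xi> v $ i = (\<chi> i. \<alpha> $ i * Z v i \<xi> / C v \<xi>) $ i"
    by (simp add: root_law_def conditioned_chain_def sp)
qed

text \<open>The reversed matrix divides by exactly the prior that occurs in the law at
  \<open>v\<close> and replaces it by the prior of the parent's spin; the sum over the spin at
  \<open>v\<close> then is \<open>Y v\<close>.\<close>

lemma root_law_rev_matrix:
  assumes "v \<in> V" "depth r E v \<le> N"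
  shows "root_law V r E \<alpha> M N \<xi> v v* rev_matrix \<alpha> M = (\<chi> i. \<alpha> $ i * Y v i \<xi> / C v \<xi>)"
proof (rule vec_eq_iff[THEN iffD2, rule_format])
  fix i
  have "\<alpha> $ j \<noteq> 0" for j using \<alpha>_pos[of j] by simp
  then show "(root_law V r E \<alpha> M N \<xi> v v* rev_matrix \<alpha> M) $ i = (\<chi> i. \<alpha> $ i * Y v i \<xi> / C v \<xi>) $ i"
    by (simp add: root_law_eq[OF assms] vector_matrix_mult_def rev_matrix_def Y_def
        sum_distrib_left sum_divide_distrib mult_ac)
qed

section \<open>Entropies\<close>

text \<open>The logarithm of the density is \<open>ln (y i) - ln c\<close>, and the constant
  \<open>ln c\<close> drops out because \<open>y i - c\<close> has mean 0 under
  \<open>\<alpha>\<close>. Nonnegativity is recorded as well, for the later conversions to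
  \<open>ennreal\<close>.\<close>

lemma sym_entropy_density:
  assumes y: "\<And>i. y i > 0" and c: "c = (\<Sum>i\<in>UNIV. \<alpha> $ i * y i)"
  shows "sym_entropy \<alpha> (\<chi> i. \<alpha> $ i * y i / c)
    = ereal ((\<Sum>i\<in>UNIV. \<alpha> $ i * ((y i - c) * ln (y i))) / c)" (is ?eq)
    and "0 \<le> (\<Sum>i\<in>UNIV. \<alpha> $ i * ((y i - c) * ln (y i))) / c" (is ?nonneg)
proof -
  let ?p = "\<chi> i. \<alpha> $ i * y i / c"
  have c0: "c > 0" unfolding c using y \<alpha>_pos by (intro sum_pos) auto
  have p: "prob_vector ?p"
    using c0 y \<alpha>_pos
    by (auto simp: prob_vector_def less_imp_le c simp flip: sum_divide_distrib)
  have na: "\<alpha> $ i \<noteq> 0" and ny: "y i \<noteq> 0" for i using \<alpha>_pos[of i] y[of i] by auto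
  have "(\<Sum>i\<in>UNIV. (?p $ i - \<alpha> $ i) * ln (?p $ i / \<alpha> $ i))
    = (\<Sum>i\<in>UNIV. \<alpha> $ i * ((y i - c) * ln (y i)) / c - (\<alpha> $ i * y i - \<alpha> $ i * c) * (ln c / c))"
    using c0 na ny y by (intro sum.cong refl) (simp add: ln_div field_simps)
  also have "\<dots> = (\<Sum>i\<in>UNIV. \<alpha> $ i * ((y i - c) * ln (y i))) / c
     - ((\<Sum>i\<in>UNIV. \<alpha> $ i * y i) - (\<Sum>i\<in>UNIV. \<alpha> $ i) * c) * (ln c / c)"
    by (simp only: sum_subtractf sum_divide_distrib sum_distrib_right left_diff_distrib)
  also have "\<dots> = (\<Sum>i\<in>UNIV. \<alpha> $ i * ((y i - c) * ln (y i))) / c"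
    by (simp add: sum_\<alpha> flip: c)
  finally show ?eq
    using c0 na ny by (simp add: sym_entropy_altdef[OF p \<alpha>_pos])
  then show ?nonneg using sym_entropy_nonneg[OF p \<alpha>_pos] by simp
qed

text \<open>The constant \<open>C v\<close> is both the normaliser of the density and the law of the
  boundary spins under \<open>P\<close>, so it cancels in the average. The function \<open>y\<close>
  stands for \<open>Z v\<close> on the left of the final identity and for \<open>Y w\<close> on its
  right.\<close>

lemma nn_integral_sym_entropy:
  assumes v: "v \<in> V" "depth r E v \<le> N"
    and y: "\<And>i \<xi>. y i \<xi> > 0" "\<And>i \<xi>. y i \<xi> = y i (restrict \<xi> (B v))"
    and C: "\<And>\<xi>. C v \<xi> = (\<Sum>i\<in>UNIV. \<alpha> $ i * y i \<xi>)"
  shows "(\<integral>\<^sup>+ \<xi>. e2ennreal (sym_entropy \<alpha> (\<chi> i. \<alpha> $ i * y i \<xi> / C v \<xi>)) \<partial>P)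
    = ennreal (\<Sum>i\<in>UNIV. \<alpha> $ i * (\<Sum>\<eta>\<in>B v \<rightarrow>\<^sub>E UNIV. (y i \<eta> - C v \<eta>) * ln (y i \<eta>)))"
    and "0 \<le> (\<Sum>i\<in>UNIV. \<alpha> $ i * (\<Sum>\<eta>\<in>B v \<rightarrow>\<^sub>E UNIV. (y i \<eta> - C v \<eta>) * ln (y i \<eta>)))"
proof -
  let ?g = "\<lambda>\<xi>. (\<Sum>i\<in>UNIV. \<alpha> $ i * ((y i \<xi> - C v \<xi>) * ln (y i \<xi>))) / C v \<xi>"
  have g0: "0 \<le> ?g \<xi>" for \<xi>
    by (rule sym_entropy_density(2)[OF y(1) C])
  have CC: "C v \<xi> = C v (restrict \<xi> (B v))" for \<xi>
    by (rule C_cong) simp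
  have "C v \<xi> \<noteq> 0" for \<xi> using C_pos[OF v, of \<xi>] by simp
  then have "(\<Sum>\<eta>\<in>B v \<rightarrow>\<^sub>E UNIV. C v \<eta> * ?g \<eta>)
     = (\<Sum>\<eta>\<in>B v \<rightarrow>\<^sub>E UNIV. \<Sum>i\<in>UNIV. \<alpha> $ i * ((y i \<eta> - C v \<eta>) * ln (y i \<eta>)))"
    by simp
  also have "\<dots> = (\<Sum>i\<in>UNIV. \<alpha> $ i * (\<Sum>\<eta>\<in>B v \<rightarrow>\<^sub>E UNIV. (y i \<eta> - C v \<eta>) * ln (y i \<eta>)))"
    unfolding sum_distrib_left by (rule sum.swap)
  finally have eq: "(\<Sum>\<eta>\<in>B v \<rightarrow>\<^sub>E UNIV. C v \<eta> * ?g \<eta>)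
     = (\<Sum>i\<in>UNIV. \<alpha> $ i * (\<Sum>\<eta>\<in>B v \<rightarrow>\<^sub>E UNIV. (y i \<eta> - C v \<eta>) * ln (y i \<eta>)))" .
  have "(\<integral>\<^sup>+ \<xi>. e2ennreal (sym_entropy \<alpha> (\<chi> i. \<alpha> $ i * y i \<xi> / C v \<xi>)) \<partial>P) = (\<integral>\<^sup>+ \<xi>. ennreal (?g \<xi>) \<partial>P)"
    by (simp add: sym_entropy_density(1)[OF y(1) C])
  also have "\<dots> = ennreal (\<Sum>\<eta>\<in>B v \<rightarrow>\<^sub>E UNIV. C v \<eta> * ?g \<eta>)"
  proof (rule nn_integral_boundary[OF v _ g0])
    show "?g \<xi> = ?g (restrict \<xi> (B v))" for \<xi>
      by (simp only: y(2)[of _ \<xi>, symmetric] CC[of \<xi>, symmetric])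
  qed
  finally show "(\<integral>\<^sup>+ \<xi>. e2ennreal (sym_entropy \<alpha> (\<chi> i. \<alpha> $ i * y i \<xi> / C v \<xi>)) \<partial>P)
    = ennreal (\<Sum>i\<in>UNIV. \<alpha> $ i * (\<Sum>\<eta>\<in>B v \<rightarrow>\<^sub>E UNIV. (y i \<eta> - C v \<eta>) * ln (y i \<eta>)))"
    by (simp only: eq)
  show "0 \<le> (\<Sum>i\<in>UNIV. \<alpha> $ i * (\<Sum>\<eta>\<in>B v \<rightarrow>\<^sub>E UNIV. (y i \<eta> - C v \<eta>) * ln (y i \<eta>)))"
    unfolding eq[symmetric] using g0 C_pos[OF v] by (intro sum_nonneg mult_nonneg_nonneg) (auto simp: less_imp_le)
qed

text \<open>The logarithm turns the product over children into a sum whose terms each depend on the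
  boundary below one child, so the other boundary spins can be summed out.\<close>

lemma sum_entropy_children:
  assumes v: "v \<in> V" "depth r E v < N"
  shows "(\<Sum>\<eta>\<in>B v \<rightarrow>\<^sub>E UNIV. (Z v i \<eta> - C v \<eta>) * ln (Z v i \<eta>))
    = (\<Sum>w\<in>ch v. \<Sum>\<eta>\<in>B w \<rightarrow>\<^sub>E UNIV. (Y w i \<eta> - C w \<eta>) * ln (Y w i \<eta>))"
proof -
  have YY: "Y w i \<eta> = Y w i (restrict \<eta> (B w))" for w \<eta> by (rule Y_cong) simp
  have "ln (Z v i \<eta>) = (\<Sum>w\<in>ch v. ln (Y w i (restrict \<eta> (B w))))" for \<eta>
  proof -
    have "ln (Z v i \<eta>) = (\<Sum>w\<in>ch v. ln (Y w i \<eta>))"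
      unfolding Z_rec[OF v] using finite_children Y_pos v by (intro ln_prod) (auto simp: less_imp_neq[symmetric])
    then show ?thesis by (simp flip: YY)
  qed
  then have "(\<Sum>\<eta>\<in>B v \<rightarrow>\<^sub>E UNIV. (Z v i \<eta> - C v \<eta>) * ln (Z v i \<eta>))
    = (\<Sum>w\<in>ch v. \<Sum>\<eta>\<in>B v \<rightarrow>\<^sub>E UNIV. Z v i \<eta> * ln (Y w i (restrict \<eta> (B w)))
        - C v \<eta> * ln (Y w i (restrict \<eta> (B w))))"
    by (subst sum.swap) (simp add: sum_distrib_left left_diff_distrib sum_subtractf)
  \<comment> \<open>Taking marginals on \<open>B w\<close> replaces \<open>Z v i\<close> by
    \<open>Y w i\<close> and \<open>C v\<close> by \<open>C w\<close>.\<close>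
  also have "\<dots> = (\<Sum>w\<in>ch v. \<Sum>\<eta>\<in>B w \<rightarrow>\<^sub>E UNIV. (Y w i \<eta> - C w \<eta>) * ln (Y w i \<eta>))"
    unfolding sum_subtractf left_diff_distrib
    using sum_Z_marginal[OF v, where F = "\<lambda>\<eta>. ln (Y _ i \<eta>)"]
      sum_C_marginal[OF v, where F = "\<lambda>\<eta>. ln (Y _ i \<eta>)"]
    by simp
  finally show ?thesis .
qed

lemma entropy_decomposition:
  assumes v: "v \<in> V" "depth r E v < N"
  shows "(\<integral>\<^sup>+ \<xi>. e2ennreal (sym_entropy \<alpha> (root_law V r E \<alpha> M N \<xi> v)) \<partial>P) =
    (\<Sum>w\<in>ch v. \<integral>\<^sup>+ \<xi>. e2ennreal (sym_entropy \<alpha> (root_law V r E \<alpha> M N \<xi> w v* rev_matrix \<alpha> M)) \<partial>P)"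
proof -
  let ?R = "\<lambda>w. \<Sum>i\<in>UNIV. \<alpha> $ i * (\<Sum>\<eta>\<in>B w \<rightarrow>\<^sub>E UNIV. (Y w i \<eta> - C w \<eta>) * ln (Y w i \<eta>))"
  have w: "(\<integral>\<^sup>+ \<xi>. e2ennreal (sym_entropy \<alpha> (root_law V r E \<alpha> M N \<xi> w v* rev_matrix \<alpha> M)) \<partial>P)
      = ennreal (?R w)" "0 \<le> ?R w" if "w \<in> ch v" for w
  proof -
    have wV: "w \<in> V" "depth r E w \<le> N" using that v edges_in depth_child[of v w] by auto
    \<comment> \<open>The child may lie on level \<open>N\<close>, where \<open>Z w\<close> vanishes
      at all spins but one; the density of the law after the reversed step is still
      positive.\<close>
    have "Y w i \<xi> > 0" for i \<xi> using that v Y_pos by auto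
    moreover have "Y w i \<xi> = Y w i (restrict \<xi> (B w))" for i \<xi> by (rule Y_cong) simp
    ultimately show "(\<integral>\<^sup>+ \<xi>. e2ennreal (sym_entropy \<alpha> (root_law V r E \<alpha> M N \<xi> w v* rev_matrix \<alpha> M)) \<partial>P)
      = ennreal (?R w)" "0 \<le> ?R w"
      unfolding root_law_rev_matrix[OF wV]
      by (rule nn_integral_sym_entropy[OF wV _ _ C_eq_sum_Y])+
  qed
  have v': "depth r E v \<le> N" using v by simp
  have ZZ: "Z v i \<xi> = Z v i (restrict \<xi> (B v))" for i \<xi> by (rule Z_cong) simp
  have "(\<integral>\<^sup>+ \<xi>. e2ennreal (sym_entropy \<alpha> (root_law V r E \<alpha> M N \<xi> v)) \<partial>P)
    = ennreal (\<Sum>i\<in>UNIV. \<alpha> $ i * (\<Sum>\<eta>\<in>B v \<rightarrow>\<^sub>E UNIV. (Z v i \<eta> - C v \<eta>) * ln (Z v i \<eta>)))"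
    unfolding root_law_eq[OF v(1) v']
    by (rule nn_integral_sym_entropy(1)[OF v(1) v' Z_pos[OF v] ZZ C_def])
  also have "\<dots> = ennreal (\<Sum>w\<in>ch v. ?R w)"
    unfolding sum_entropy_children[OF v] sum_distrib_left by (subst sum.swap) simp
  \<comment> \<open>Additivity of \<open>ennreal\<close> relies on every summand being nonnegative,
    which was obtained from the nonnegativity of the entropy.\<close>
  also have "\<dots> = (\<Sum>w\<in>ch v. ennreal (?R w))"
    using w(2) by (intro sum_ennreal[symmetric])
  finally show ?thesis using w(1) by simp
qed

end

theorem proposition3p3:
  fixes V :: "'v set" and r v :: 'v and E :: "('v \<times> 'v) set"
    and M :: "real ^ 's ^ 's" and \<alpha> :: "real ^ 's"
    and P :: "('v \<Rightarrow> 's) measure" and N :: nat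
  assumes "CARD('s) \<ge> 2"
    and "stochastic_matrix M" and "\<And>i j. M $ i $ j > 0"
    and "prob_vector \<alpha>" and "\<alpha> v* M = \<alpha>"
    and "rooted_tree V r E" and "infinite V"
    and "\<And>u. u \<in> V \<Longrightarrow> \<exists>w. (u, w) \<in> E"
    and "\<And>u. u \<in> V \<Longrightarrow> finite {w. (u, w) \<in> E}"
    and "tree_markov_chain V r E \<alpha> M P"
    and "N \<ge> 1" and "v \<in> V" and "depth r E v < N"
  shows "(\<integral>\<^sup>+ \<xi>. e2ennreal (sym_entropy \<alpha> (root_law V r E \<alpha> M N \<xi> v)) \<partial>P) =
    (\<Sum>w | (v, w) \<in> E.
      \<integral>\<^sup>+ \<xi>. e2ennreal (sym_entropy \<alpha> (root_law V r E \<alpha> M N \<xi> w v* rev_matrix \<alpha> M)) \<partial>P)"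
proof -
  interpret tree_chain V r E M \<alpha> P N
    using assms by (intro tree_chain.intro tree_chain_axioms.intro)
  show ?thesis by (rule entropy_decomposition) fact+
qed

end
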